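(* Let $G$ be an instance of the scheduling game $R||\sum_jw_jC_j$ such that for all jobs $j,k$ and all machines $i$: $\rho_{ij}\le\rho_{ik}$ implies $w_j\le w_k$. Then the robust price of anarchy of every friendship extension $G^\alpha$ of $G$ is at most $4$.
   Context: Scheduling game $R||\sum_jw_jC_j$: there are jobs (players) $[n]=\{1,\dots,n\}$ and machines $[m]=\{1,\dots,m\}$; job $j$ has processing time $p_{ij}\in\mathbb R_+$ on machine $i$ and weight $w_j>0$. Each job's strategy set is $[m]$; in a profile (schedule) $x$, $x_j$ is the machine of job $j$ and $X_i=\{j: x_j=i\}$. Put $\rho_{ij}=p_{ij}/w_j$. On each machine $i$ the assigned jobs are processed in increasing order of $\rho_{ij}$ (Smith's rule), ties being broken by a fixed tie-breaking rule (so for each machine there is a fixed total order of the jobs refining the order by $\rho_{ij}$). The cost $C_j(x)$ of job $j$ is its completion time: the sum of $p_{ik}$ over all $k\in X_i$, $i=x_j$, that do not come after $j$ in this order (including $j$ itself); when the $\rho_{ij}$ are pairwise distinct, $C_j(x)=\sum_{k\in X_i:\rho_{ik}\le\rho_{ij}}p_{ik}$. The social cost is $C(x)=\sum_jw_jC_j(x)$. Friendship extension: for $\alpha\in[0,1]^{n\times n}$ with $\alpha_{jj}=1$ for all $j$, $G^\alpha$ is the game with the same players and strategies and costs $C_j^\alpha=\sum_k\alpha_{jk}C_k$; its social cost is again $C$. Smoothness: $G^\alpha$ is $(\lambda,\mu)$-smooth if there is a (possibly randomized) schedule $\bar x$ such that for all schedules $x$ and all optimal schedules $x^*$ (minimizers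 of $C$), $$\sum_jw_j\Big(C_j(\bar x_j,x_{-j})+\sum_{k\ne j}\alpha_{jk}\big(C_k(\bar x_j,x_{-j})-C_k(x)\big)\Big)\le\lambda C(x^* )+\mu C(x)$$ (left-hand side in expectation over $\bar x$ if it is randomized), where $(\bar x_j,x_{-j})$ is $x$ with job $j$ moved to $\bar x_j$. The robust price of anarchy of $G^\alpha$ is $\inf\{\frac{\lambda}{1-\mu} : G^\alpha\text{ is }(\lambda,\mu)\text{-smooth},\ \mu<1\}$. *)

theory Defs
  imports "HOL-Probability.Probability_Mass_Function"
begin

text \<open>
  Jobs are \<open>1, \<dots>, num_jobs G\<close> and machines are \<open>1, \<dots>, num_machines G\<close>. As usual in the
  scheduling literature, the machine index comes first: \<open>ptime G i j\<close> is the processing time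
  of job \<open>j\<close> on machine \<open>i\<close>. A pair \<open>(j, k)\<close> in \<open>prio G i\<close> means that on machine \<open>i\<close>
  job \<open>j\<close> does not come after job \<open>k\<close>.
\<close>

record sched_instance =
  num_jobs :: nat
  num_machines :: nat
  ptime :: "nat \<Rightarrow> nat \<Rightarrow> real"
  weight :: "nat \<Rightarrow> real"
  prio :: "nat \<Rightarrow> nat rel"

abbreviation jobs :: "sched_instance \<Rightarrow> nat set" where
  "jobs G \<equiv> {1..num_jobs G}"

abbreviation machines :: "sched_instance \<Rightarrow> nat set" where
  "machines G \<equiv> {1..num_machines G}"

definition rho :: "sched_instance \<Rightarrow> nat \<Rightarrow> nat \<Rightarrow> real" where
  "rho G i j = ptime G i j / weight G j"

text \<open>
  The last clause is Smith's rule with a fixed tie-breaking rule: each \<open>prio G i\<close> is a total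
  order of the jobs that refines the order by \<open>rho G i\<close>. The tie-breaking may depend on the
  machine.
\<close>

definition valid_instance :: "sched_instance \<Rightarrow> bool" where
  "valid_instance G \<longleftrightarrow>
     num_machines G \<ge> 1 \<and>
     (\<forall>i\<in>machines G. \<forall>j\<in>jobs G. ptime G i j \<ge> 0) \<and>
     (\<forall>j\<in>jobs G. weight G j > 0) \<and>
     (\<forall>i\<in>machines G. linear_order_on (jobs G) (prio G i) \<and>
        (\<forall>(j, k)\<in>prio G i. rho G i j \<le> rho G i k))"

definition schedules :: "sched_instance \<Rightarrow> (nat \<Rightarrow> nat) set" where
  "schedules G = jobs G \<rightarrow>\<^sub>E machines G"

definition completion_time :: "sched_instance \<Rightarrow> nat \<Rightarrow> (nat \<Rightarrow> nat) \<Rightarrow> real" where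
  "completion_time G j x =
     (\<Sum>k | k \<in> jobs G \<and> x k = x j \<and> (k, j) \<in> prio G (x j). ptime G (x j) k)"

definition social_cost :: "sched_instance \<Rightarrow> (nat \<Rightarrow> nat) \<Rightarrow> real" where
  "social_cost G x = (\<Sum>j\<in>jobs G. weight G j * completion_time G j x)"

definition optimal_schedule :: "sched_instance \<Rightarrow> (nat \<Rightarrow> nat) \<Rightarrow> bool" where
  "optimal_schedule G x \<longleftrightarrow> is_arg_min (social_cost G) (\<lambda>y. y \<in> schedules G) x"

text \<open>
  The extension of \<open>G\<close> by a friendship matrix \<open>\<alpha>\<close> is represented by the pair of \<open>G\<close> and \<open>\<alpha>\<close>,
  because smoothness refers to \<open>\<alpha>\<close> and to the completion times of \<open>G\<close> separately.
\<close>

definition friendship_matrix :: "sched_instance \<Rightarrow> (nat \<Rightarrow> nat \<Rightarrow> real) \<Rightarrow> bool" where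
  "friendship_matrix G \<alpha> \<longleftrightarrow>
     (\<forall>j\<in>jobs G. \<forall>k\<in>jobs G. 0 \<le> \<alpha> j k \<and> \<alpha> j k \<le> 1) \<and> (\<forall>j\<in>jobs G. \<alpha> j j = 1)"

text \<open>Here \<open>x(j := xb j)\<close> is the schedule \<open>x\<close> with job \<open>j\<close> moved to its machine in \<open>xb\<close>.\<close>

definition deviation_cost ::
  "sched_instance \<Rightarrow> (nat \<Rightarrow> nat \<Rightarrow> real) \<Rightarrow> (nat \<Rightarrow> nat) \<Rightarrow> (nat \<Rightarrow> nat) \<Rightarrow> real" where
  "deviation_cost G \<alpha> xb x =
     (\<Sum>j\<in>jobs G. weight G j *
        (completion_time G j (x(j := xb j)) +
         (\<Sum>k\<in>jobs G - {j}. \<alpha> j k *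
            (completion_time G k (x(j := xb j)) - completion_time G k x))))"

text \<open>
  The randomized schedule is an arbitrary joint distribution \<open>q\<close> on schedules; a point mass
  gives a deterministic schedule.
\<close>

definition smooth ::
  "sched_instance \<Rightarrow> (nat \<Rightarrow> nat \<Rightarrow> real) \<Rightarrow> real \<Rightarrow> real \<Rightarrow> bool" where
  "smooth G \<alpha> l \<mu> \<longleftrightarrow>
     (\<exists>q. set_pmf q \<subseteq> schedules G \<and>
        (\<forall>x\<in>schedules G. \<forall>xs. optimal_schedule G xs \<longrightarrow>
           measure_pmf.expectation q (\<lambda>xb. deviation_cost G \<alpha> xb x)
             \<le> l * social_cost G xs + \<mu> * social_cost G x))"

text \<open>
  The infimum is taken in the extended reals, so it is \<open>\<infinity>\<close> if no admissible pair exists.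
\<close>

definition robust_poa :: "sched_instance \<Rightarrow> (nat \<Rightarrow> nat \<Rightarrow> real) \<Rightarrow> ereal" where
  "robust_poa G \<alpha> = Inf {ereal (l / (1 - \<mu>)) | l \<mu>. smooth G \<alpha> l \<mu> \<and> \<mu> < 1}"

end

theory Submission imports Defs begin

text \<open>
  Smith's rule gives \<open>2 C(x) = \<langle>x, x\<rangle> + P(x)\<close>, where \<open>P(x)\<close> is the weighted sum of processing
  times and \<open>\<langle>x, y\<rangle>\<close> sums \<open>w\<^sub>j w\<^sub>k min(\<rho>\<^sub>i\<^sub>j, \<rho>\<^sub>i\<^sub>k)\<close> over all \<open>j\<close>, \<open>k\<close> with \<open>x\<^sub>j = i = y\<^sub>k\<close>. Let
  \<open>y\<close> be optimal. A job \<open>j\<close> that moves to machine \<open>i = y\<^sub>j\<close> delays only the jobs \<open>k\<close> that come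
  after it there, each by \<open>p\<^sub>i\<^sub>j\<close>, and \<open>w\<^sub>j p\<^sub>i\<^sub>j \<le> w\<^sub>j w\<^sub>k \<rho>\<^sub>i\<^sub>j\<close> because \<open>w\<^sub>j \<le> w\<^sub>k\<close>. Hence the
  deviation cost is at most \<open>P(y) + \<langle>y, x\<rangle>\<close>, whatever the friendship matrix. The kernel
  \<open>min\<close> is positive semidefinite, so \<open>\<langle>y, x\<rangle> \<le> \<langle>y, y\<rangle> + \<langle>x, x\<rangle> / 4\<close>, which yields
  \<open>(2, 1/2)\<close>-smoothness.
\<close>

section \<open>Positive semidefiniteness of the kernel \<open>min\<close>\<close>

text \<open>The case \<open>m = 0\<close> is semidefiniteness; a general lower bound
  \<open>m\<close> makes the induction work. The index \<open>x\<close> added last has the smallest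
  value, so its row and column carry the constant factor \<open>r x\<close>, and the induction
  hypothesis for the rest is used with \<open>m = r x\<close>.\<close>

lemma min_kernel_ge:
  fixes c r :: "'a \<Rightarrow> real"
  assumes "finite A" and "\<And>j. j \<in> A \<Longrightarrow> m \<le> r j"
  shows "m * (\<Sum>j\<in>A. c j)\<^sup>2 \<le> (\<Sum>j\<in>A. \<Sum>k\<in>A. c j * c k * min (r j) (r k))"
  using assms
proof (induction A arbitrary: m rule: finite_ranking_induct[where f = "\<lambda>j. - r j"])
  case (insert x S)
  show ?case
  proof (cases "x \<in> S")
    case True
    then show ?thesis using insert by (simp add: insert_absorb)
  next
    case False
    let ?s = "\<Sum>j\<in>S. c j"
    have le: "r x \<le> r y" if "y \<in> S" for y using insert(2)[OF that] by simp
    have row: "(\<Sum>k\<in>S. c x * c k * min (r x) (r k)) = c x * r x * ?s"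
      unfolding sum_distrib_left by (rule sum.cong) (simp_all add: le min_absorb1)
    have col: "(\<Sum>j\<in>S. c j * c x * min (r j) (r x)) = c x * r x * ?s"
      unfolding sum_distrib_left by (rule sum.cong) (simp_all add: le min_absorb2)
    have "m * (c x + ?s)\<^sup>2 \<le> r x * (c x + ?s)\<^sup>2"
      using insert.prems by (intro mult_right_mono) auto
    also have "\<dots> = c x * c x * r x + 2 * (c x * r x * ?s) + r x * ?s\<^sup>2"
      by (simp add: power2_eq_square algebra_simps)
    also have "\<dots> \<le> c x * c x * r x + 2 * (c x * r x * ?s)
        + (\<Sum>j\<in>S. \<Sum>k\<in>S. c j * c k * min (r j) (r k))"
      using insert.IH[of "r x"] le by simp
    also have "\<dots> = (\<Sum>j\<in>insert x S. \<Sum>k\<in>insert x S. c j * c k * min (r j) (r k))"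
      using insert(1) False by (simp add: sum.distrib row col)
    finally show ?thesis using insert(1) False by simp
  qed
qed simp

section \<open>The bilinear form and its Cauchy-Schwarz type bound\<close>

text \<open>For two distinct jobs sharing machine \<open>i\<close>, this is the weighted delay that
  the earlier one causes the later one.\<close>

definition smith_term :: "sched_instance \<Rightarrow> nat \<Rightarrow> nat \<Rightarrow> nat \<Rightarrow> real" where
  "smith_term G i j k = weight G j * weight G k * min (rho G i j) (rho G i k)"

definition smith_form :: "sched_instance \<Rightarrow> (nat \<Rightarrow> nat) \<Rightarrow> (nat \<Rightarrow> nat) \<Rightarrow> real" where
  "smith_form G x y =
     (\<Sum>j\<in>jobs G. \<Sum>k\<in>jobs G. if y k = x j then smith_term G (x j) j k else 0)"

definition processing_cost :: "sched_instance \<Rightarrow> (nat \<Rightarrow> nat) \<Rightarrow> real" where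
  "processing_cost G x = (\<Sum>j\<in>jobs G. weight G j * ptime G (x j) j)"

lemma smith_term_commute: "smith_term G i j k = smith_term G i k j"
  by (simp add: smith_term_def min.commute mult.commute)

text \<open>With indicators the form splits into one quadratic expression per machine, to which
  \<open>min_kernel_ge\<close> applies.\<close>

lemma smith_form_by_machine:
  assumes "x \<in> schedules G"
  shows "smith_form G x y = (\<Sum>i\<in>machines G. \<Sum>j\<in>jobs G. \<Sum>k\<in>jobs G.
    of_bool (x j = i) * of_bool (y k = i) * smith_term G i j k)"
proof -
  have "(\<Sum>k\<in>jobs G. if y k = x j then smith_term G (x j) j k else 0) =
     (\<Sum>i\<in>machines G. \<Sum>k\<in>jobs G. of_bool (x j = i) * of_bool (y k = i) * smith_term G i j k)"
    if "j \<in> jobs G" for j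
  proof -
    have "x j \<in> machines G" using assms that by (auto simp: schedules_def)
    then have "(\<Sum>k\<in>jobs G. if y k = x j then smith_term G (x j) j k else 0) =
       (\<Sum>i\<in>machines G. if x j = i then
          \<Sum>k\<in>jobs G. if y k = i then smith_term G i j k else 0 else 0)"
      by (subst sum.delta') auto
    also have "\<dots> = (\<Sum>i\<in>machines G. \<Sum>k\<in>jobs G.
        of_bool (x j = i) * of_bool (y k = i) * smith_term G i j k)"
    proof (intro sum.cong refl)
      fix i
      have "(if y k = i then smith_term G i j k else 0) = of_bool (y k = i) * smith_term G i j k"
        for k by simp
      then show "(if x j = i then \<Sum>k\<in>jobs G. if y k = i then smith_term G i j k else 0 else 0)
        = (\<Sum>k\<in>jobs G. of_bool (x j = i) * of_bool (y k = i) * smith_term G i j k)"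
        by (cases "x j = i") (simp_all only: if_True if_False of_bool_eq refl
            mult_1 mult_zero_left sum.neutral_const)
    qed
    finally show ?thesis .
  qed
  then show ?thesis
    unfolding smith_form_def by (subst sum.swap) (rule sum.cong, auto)
qed

lemma smith_form_commute: "smith_form G x y = smith_form G y x"
  unfolding smith_form_def
  by (subst sum.swap, intro sum.cong) (auto simp: smith_term_commute)

lemma valid_instanceD:
  assumes "valid_instance G"
  shows "j \<in> jobs G \<Longrightarrow> weight G j > 0"
    and "i \<in> machines G \<Longrightarrow> j \<in> jobs G \<Longrightarrow> ptime G i j \<ge> 0"
    and "i \<in> machines G \<Longrightarrow> j \<in> jobs G \<Longrightarrow> rho G i j \<ge> 0"
    and "i \<in> machines G \<Longrightarrow> (j, k) \<in> prio G i \<Longrightarrow> rho G i j \<le> rho G i k"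
    and "i \<in> machines G \<Longrightarrow> linear_order_on (jobs G) (prio G i)"
    and "j \<in> jobs G \<Longrightarrow> weight G j * rho G i j = ptime G i j"
  using assms unfolding valid_instance_def rho_def
  by (auto simp: less_imp_le less_le[of 0] intro!: divide_nonneg_nonneg)

lemma prio_cases:
  assumes "valid_instance G" "i \<in> machines G" "j \<in> jobs G" "k \<in> jobs G" "j \<noteq> k"
  shows "(j, k) \<in> prio G i \<and> (k, j) \<notin> prio G i \<or> (k, j) \<in> prio G i \<and> (j, k) \<notin> prio G i"
proof -
  have "total_on (jobs G) (prio G i)" "antisym (prio G i)"
    using valid_instanceD(5)[OF assms(1,2)]
    by (simp_all add: linear_order_on_def partial_order_on_def)
  then show ?thesis using assms(3-5) unfolding total_on_def by (metis antisymD)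
qed

lemma prio_refl:
  assumes "valid_instance G" "i \<in> machines G" "j \<in> jobs G"
  shows "(j, j) \<in> prio G i"
  using valid_instanceD(5)[OF assms(1,2)] assms(3)
  by (auto simp: linear_order_on_def partial_order_on_def preorder_on_def refl_on_def)

lemma smith_form_le:
  assumes "x \<in> schedules G" "y \<in> schedules G" and G: "valid_instance G"
  shows "smith_form G y x \<le> smith_form G y y + smith_form G x x / 4"
proof -
  define B where "B x y = (\<lambda>i. \<Sum>j\<in>jobs G. \<Sum>k\<in>jobs G.
    of_bool (x j = i) * of_bool (y k = i) * smith_term G i j k)" for x y :: "nat \<Rightarrow> nat"
  have "0 \<le> B y y i + B x x i / 4 - B x y i / 2 - B y x i / 2" if i: "i \<in> machines G" for i
  proof -
    \<comment> \<open>This encodes y - x/2; the factor 1/2 makes the two mixed terms, equal by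
      symmetry, add up to exactly \<langle>y, x\<rangle>.\<close>
    define c where
      "c j = weight G j * (of_bool (y j = i) - of_bool (x j = i) / 2)" for j
    have "0 \<le> (\<Sum>j\<in>jobs G. \<Sum>k\<in>jobs G. c j * c k * min (rho G i j) (rho G i k))"
      using min_kernel_ge[of "jobs G" 0 "rho G i" c] valid_instanceD(3)[OF G i] by simp
    also have "\<dots> = B y y i + B x x i / 4 - B x y i / 2 - B y x i / 2"
      unfolding B_def sum_divide_distrib sum.distrib[symmetric] sum_subtractf[symmetric]
      by (intro sum.cong refl) (simp add: c_def smith_term_def field_simps)
    finally show ?thesis .
  qed
  then have "0 \<le> (\<Sum>i\<in>machines G. B y y i + B x x i / 4 - B x y i / 2 - B y x i / 2)"
    by (rule sum_nonneg)
  also have "\<dots> = smith_form G y y + smith_form G x x / 4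
      - smith_form G x y / 2 - smith_form G y x / 2"
    using assms
    by (simp add: smith_form_by_machine B_def sum.distrib sum_subtractf sum_divide_distrib)
  finally show ?thesis using smith_form_commute[of G x y] by simp
qed

section \<open>Social cost in terms of the form\<close>

text \<open>Symmetrizing the cost over ordered pairs counts two distinct jobs on one machine once in
  each order, as the form does. The diagonal is counted twice, which leaves one extra copy of the
  processing cost.\<close>

lemma two_social_cost:
  assumes G: "valid_instance G" and x: "x \<in> schedules G"
  shows "2 * social_cost G x = smith_form G x x + processing_cost G x"
proof -
  define t where "t j k = (if x k = x j \<and> (k, j) \<in> prio G (x j)
    then smith_term G (x j) j k else 0)" for j k
  have xm: "x j \<in> machines G" if "j \<in> jobs G" for j
    using x that by (auto simp: schedules_def)
  have "weight G j * completion_time G j x = (\<Sum>k\<in>jobs G. t j k)" if j: "j \<in> jobs G" for j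
  proof -
    have "weight G j * ptime G (x j) k = smith_term G (x j) j k"
      if k: "k \<in> jobs G" "(k, j) \<in> prio G (x j)" for k
      using valid_instanceD(4)[OF G xm[OF j] k(2)] valid_instanceD(6)[OF G k(1), of "x j"]
      by (simp add: smith_term_def min_def)
    moreover have "completion_time G j x = (\<Sum>k\<in>jobs G.
        if x k = x j \<and> (k, j) \<in> prio G (x j) then ptime G (x j) k else 0)"
      unfolding completion_time_def
      by (subst sum.inter_filter[symmetric]) auto
    ultimately show ?thesis
      by (auto simp: sum_distrib_left t_def intro!: sum.cong)
  qed
  then have C: "social_cost G x = (\<Sum>j\<in>jobs G. \<Sum>k\<in>jobs G. t j k)"
    unfolding social_cost_def by (intro sum.cong) auto
  then have C': "social_cost G x = (\<Sum>j\<in>jobs G. \<Sum>k\<in>jobs G. t k j)"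
    by (subst (asm) sum.swap) simp
  have P: "processing_cost G x =
      (\<Sum>j\<in>jobs G. \<Sum>k\<in>jobs G. if k = j then smith_term G (x j) j k else 0)"
    unfolding processing_cost_def
  proof (intro sum.cong refl)
    fix j assume j: "j \<in> jobs G"
    then show "weight G j * ptime G (x j) j =
        (\<Sum>k\<in>jobs G. if k = j then smith_term G (x j) j k else 0)"
      using valid_instanceD(6)[OF G j, of "x j"]
      by (subst sum.delta) (auto simp: smith_term_def)
  qed
  have "2 * social_cost G x = (\<Sum>j\<in>jobs G. \<Sum>k\<in>jobs G. t j k + t k j)"
    using C C' by (simp add: sum.distrib)
  also have "\<dots> = (\<Sum>j\<in>jobs G. \<Sum>k\<in>jobs G.
      (if x k = x j then smith_term G (x j) j k else 0) +
      (if k = j then smith_term G (x j) j k else 0))"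
  proof (intro sum.cong refl)
    fix j k assume jk: "j \<in> jobs G" "k \<in> jobs G"
    show "t j k + t k j = (if x k = x j then smith_term G (x j) j k else 0) +
      (if k = j then smith_term G (x j) j k else 0)"
      using prio_cases[OF G xm[OF jk(1)] jk] prio_refl[OF G xm[OF jk(1)] jk(1)]
      by (cases "j = k") (auto simp: t_def smith_term_commute[of G _ k j])
  qed
  also have "\<dots> = smith_form G x x + processing_cost G x"
    unfolding smith_form_def P by (simp only: sum.distrib)
  finally show ?thesis .
qed

section \<open>Cost of a deviation\<close>

lemma completion_time_move_le:
  assumes G: "valid_instance G" and x: "x \<in> schedules G"
    and jk: "j \<in> jobs G" "k \<in> jobs G" "k \<noteq> j" and i: "i \<in> machines G"
  shows "completion_time G k (x(j := i)) - completion_time G k x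
    \<le> (if x k = i \<and> (j, k) \<in> prio G i then ptime G i j else 0)"
proof -
  have xk: "x k \<in> machines G" using x jk by (auto simp: schedules_def)
  let ?S = "{l \<in> jobs G. x l = x k \<and> (l, k) \<in> prio G (x k)}"
  let ?J = "if x k = i \<and> (j, k) \<in> prio G i then {j} else {}"
  have "completion_time G k (x(j := i)) \<le> sum (ptime G (x k)) (?S \<union> ?J)"
    unfolding completion_time_def using jk valid_instanceD(2)[OF G xk]
    by (auto intro!: sum_mono2 split: if_splits)
  \<comment> \<open>The union need not be disjoint, since \<open>j\<close> may already be on machine
    \<open>i\<close>; the overlap has a nonnegative sum.\<close>
  also have "\<dots> \<le> sum (ptime G (x k)) ?S + sum (ptime G (x k)) ?J"
    using jk valid_instanceD(2)[OF G xk] by (subst sum_Un) (auto intro!: sum_nonneg)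
  also have "sum (ptime G (x k)) ?S = completion_time G k x"
    by (simp only: completion_time_def)
  also have "sum (ptime G (x k)) ?J = (if x k = i \<and> (j, k) \<in> prio G i then ptime G i j else 0)"
    by simp
  finally show ?thesis by linarith
qed

lemma deviation_cost_le:
  assumes G: "valid_instance G" and x: "x \<in> schedules G" and y: "y \<in> schedules G"
    and mono: "\<forall>i\<in>machines G. \<forall>j\<in>jobs G. \<forall>k\<in>jobs G.
           rho G i j \<le> rho G i k \<longrightarrow> weight G j \<le> weight G k"
    and \<alpha>: "friendship_matrix G \<alpha>"
  shows "deviation_cost G \<alpha> y x \<le> processing_cost G y + smith_form G y x"
  unfolding deviation_cost_def processing_cost_def smith_form_def sum.distrib[symmetric]
proof (rule sum_mono)
  fix j assume j: "j \<in> jobs G"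
  let ?i = "y j"
  let ?K = "jobs G - {j}"
  let ?before = "\<lambda>k. if x k = ?i \<and> (k, j) \<in> prio G ?i then ptime G ?i k else 0"
  let ?after = "\<lambda>k. if x k = ?i \<and> (j, k) \<in> prio G ?i then ptime G ?i j else 0"
  let ?q = "\<lambda>k. if x k = ?i then smith_term G ?i j k else 0"
  have i: "?i \<in> machines G" using y j by (auto simp: schedules_def)
  have w: "weight G j > 0" using valid_instanceD(1)[OF G j] .
  have "completion_time G j (x(j := ?i)) =
     (\<Sum>k\<in>jobs G. if (x(j := ?i)) k = ?i \<and> (k, j) \<in> prio G ?i then ptime G ?i k else 0)"
    unfolding completion_time_def by (subst sum.inter_filter[symmetric]) auto
  also have "\<dots> = ptime G ?i j + (\<Sum>k\<in>?K. ?before k)"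
    using prio_refl[OF G i j] j by (subst sum.remove[of _ j]) (auto intro!: sum.cong)
  finally have C: "completion_time G j (x(j := ?i)) = ptime G ?i j + (\<Sum>k\<in>?K. ?before k)" .
  \<comment> \<open>The difference may be negative, so it is first replaced by its nonnegative
    bound; only then is the factor \<open>\<alpha> j k \<le> 1\<close> dropped.\<close>
  have D: "\<alpha> j k * (completion_time G k (x(j := ?i)) - completion_time G k x) \<le> ?after k"
    if k: "k \<in> ?K" for k
  proof -
    have "0 \<le> \<alpha> j k" "\<alpha> j k \<le> 1" using \<alpha> j k by (auto simp: friendship_matrix_def)
    moreover have "0 \<le> ?after k" using valid_instanceD(2)[OF G i j] by simp
    moreover have "completion_time G k (x(j := ?i)) - completion_time G k x \<le> ?after k"
      using completion_time_move_le[OF G x j _ _ i] k by auto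
    ultimately show ?thesis
      by (meson mult_left_le_one_le mult_left_mono order_trans)
  qed
  \<comment> \<open>Exactly one of \<open>j\<close>, \<open>k\<close> precedes the other: if
    \<open>k\<close> does, equality holds; if \<open>j\<close> does,
    \<open>w\<^sub>j \<le> w\<^sub>k\<close> is needed.\<close>
  have E: "weight G j * (?before k + ?after k) \<le> ?q k" if k: "k \<in> ?K" for k
  proof (cases "x k = ?i")
    case True
    have k': "k \<in> jobs G" "j \<noteq> k" using k by auto
    note p = valid_instanceD(6)[OF G j, of ?i] valid_instanceD(6)[OF G k'(1), of ?i]
    consider "(j, k) \<in> prio G ?i" "(k, j) \<notin> prio G ?i"
      | "(k, j) \<in> prio G ?i" "(j, k) \<notin> prio G ?i"
      using prio_cases[OF G i j k'] by blast
    then show ?thesis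
    proof cases
      case 1
      have r: "rho G ?i j \<le> rho G ?i k" using valid_instanceD(4)[OF G i 1(1)] .
      then have "weight G j \<le> weight G k" using mono i j k' by blast
      then have "weight G j * (weight G j * rho G ?i j) \<le> weight G j * (weight G k * rho G ?i j)"
        using w valid_instanceD(3)[OF G i j] by (intro mult_left_mono mult_right_mono) auto
      then show ?thesis using 1 True r p by (simp add: smith_term_def min_def)
    next
      case 2
      then show ?thesis using True valid_instanceD(4)[OF G i 2(1)]
        by (simp add: smith_term_def min_absorb2 mult.assoc p)
    qed
  qed simp
  have q0: "0 \<le> ?q j"
    using w valid_instanceD(3)[OF G i j] by (simp add: smith_term_def)
  have "weight G j * (completion_time G j (x(j := ?i)) +
      (\<Sum>k\<in>?K. \<alpha> j k * (completion_time G k (x(j := ?i)) - completion_time G k x)))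
    \<le> weight G j * (ptime G ?i j + (\<Sum>k\<in>?K. ?before k) + (\<Sum>k\<in>?K. ?after k))"
    unfolding C using w D by (intro mult_left_mono add_left_mono sum_mono) auto
  also have "\<dots> = weight G j * ptime G ?i j + (\<Sum>k\<in>?K. weight G j * (?before k + ?after k))"
    by (simp only: sum.distrib sum_distrib_left[symmetric] distrib_left add.assoc)
  also have "\<dots> \<le> weight G j * ptime G ?i j + (\<Sum>k\<in>?K. ?q k)"
    using E by (intro add_left_mono sum_mono) auto
  \<comment> \<open>Adding the nonnegative term for \<open>k = j\<close> completes the row of the
    form.\<close>
  also have "\<dots> \<le> weight G j * ptime G ?i j + (\<Sum>k\<in>jobs G. ?q k)"
    using q0 j by (subst (2) sum.remove[of _ j]) auto
  finally show "weight G j * (completion_time G j (x(j := ?i)) +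
      (\<Sum>k\<in>?K. \<alpha> j k * (completion_time G k (x(j := ?i)) - completion_time G k x)))
    \<le> weight G j * ptime G ?i j + (\<Sum>k\<in>jobs G. ?q k)" .
qed

section \<open>Smoothness and the price of anarchy\<close>

lemma processing_cost_nonneg:
  assumes "valid_instance G" "x \<in> schedules G"
  shows "0 \<le> processing_cost G x"
  unfolding processing_cost_def
proof (intro sum_nonneg mult_nonneg_nonneg)
  fix j assume j: "j \<in> jobs G"
  show "0 \<le> weight G j" using valid_instanceD(1)[OF assms(1) j] by simp
  have "x j \<in> machines G" using assms(2) j by (auto simp: schedules_def)
  then show "0 \<le> ptime G (x j) j" using valid_instanceD(2)[OF assms(1) _ j] by blast
qed

lemma exists_optimal_schedule:
  assumes "valid_instance G"
  obtains y where "optimal_schedule G y"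
proof -
  have "finite (schedules G)" unfolding schedules_def by (simp add: finite_PiE)
  moreover have "schedules G \<noteq> {}"
    using assms by (simp add: schedules_def valid_instance_def PiE_eq_empty_iff)
  ultimately show ?thesis
    using ex_is_arg_min_if_finite[of "schedules G" "social_cost G"] that
    unfolding optimal_schedule_def by fast
qed

lemma smooth_2_half:
  assumes G: "valid_instance G"
    and mono: "\<forall>i\<in>machines G. \<forall>j\<in>jobs G. \<forall>k\<in>jobs G.
           rho G i j \<le> rho G i k \<longrightarrow> weight G j \<le> weight G k"
    and \<alpha>: "friendship_matrix G \<alpha>"
  shows "smooth G \<alpha> 2 (1 / 2)"
proof -
  obtain y where opt: "optimal_schedule G y" using exists_optimal_schedule[OF G] .
  then have y: "y \<in> schedules G" by (simp add: optimal_schedule_def is_arg_min_def)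
  have "deviation_cost G \<alpha> y x \<le> 2 * social_cost G z + 1 / 2 * social_cost G x"
    if x: "x \<in> schedules G" and z: "optimal_schedule G z" for x z
  proof -
    \<comment> \<open>All optima have equal cost, so one fixed \<open>y\<close> serves against every
      optimal \<open>z\<close>.\<close>
    have "social_cost G y = social_cost G z"
      using opt z by (simp add: optimal_schedule_def is_arg_min_linorder order_antisym)
    \<comment> \<open>P(y) + \<langle>y, x\<rangle> \<le> P(y) + \<langle>y, y\<rangle> +
      \<langle>x, x\<rangle>/4 = 2 C(y) + (2 C(x) - P(x))/4, and P(x) is nonnegative.\<close>
    then show ?thesis
      using deviation_cost_le[OF G x y mono \<alpha>] smith_form_le[OF x y G]
        two_social_cost[OF G x] two_social_cost[OF G y] processing_cost_nonneg[OF G x]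
      by linarith
  qed
  then show ?thesis
    unfolding smooth_def using y by (intro exI[of _ "return_pmf y"]) auto
qed

theorem theorem5:
  fixes G :: sched_instance and \<alpha> :: "nat \<Rightarrow> nat \<Rightarrow> real"
  assumes "valid_instance G"
    and "\<forall>i\<in>machines G. \<forall>j\<in>jobs G. \<forall>k\<in>jobs G.
           rho G i j \<le> rho G i k \<longrightarrow> weight G j \<le> weight G k"
    and "friendship_matrix G \<alpha>"
  shows "robust_poa G \<alpha> \<le> 4"
proof -
  have "ereal (2 / (1 - 1 / 2)) \<in> {ereal (l / (1 - \<mu>)) | l \<mu>. smooth G \<alpha> l \<mu> \<and> \<mu> < 1}"
    using smooth_2_half[OF assms] by (intro CollectI exI[of _ 2] exI[of _ "1 / 2"]) simp
  then have "robust_poa G \<alpha> \<le> ereal (2 / (1 - 1 / 2))"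
    unfolding robust_poa_def by (rule Inf_lower)
  then show ?thesis by simp
qed

end
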